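(* Let $X \subseteq \mathbb{R}^n$ be an open set, let $\tilde f : X \to F(\mathbb{R})$ be a twice continuously gH-differentiable fuzzy-valued function on $X$, and let $\bar x^* \in X$. Suppose that 1. $\displaystyle\int_0^1 \alpha \,\big[\nabla(\tilde f_\alpha^L + \tilde f_\alpha^U)(\bar x^* )\big]\, d\alpha = 0$, and 2. $\displaystyle\int_0^1 \alpha \,\big[\nabla^2(\tilde f_\alpha^L + \tilde f_\alpha^U)(\bar x^* )\big]\, d\alpha$ is a positive definite matrix, where $\nabla$ and $\nabla^2$ denote the ordinary gradient and Hessian in $\bar x$ of the real-valued function $\tilde f_\alpha^L+\tilde f_\alpha^U$ and the integrals are taken componentwise. Then $\bar x^*$ is a strict local minimizer of the problem "Minimize $\tilde f(\bar x)$, $\bar x \in X$" (with respect to the linear order relation on $F(\mathbb{R})$).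
   Context: Fuzzy numbers. A fuzzy number is a function $\tilde a:\mathbb{R}\to[0,1]$ such that: (i) $\tilde a(r_0)=1$ for some $r_0\in\mathbb{R}$; (ii) $\tilde a(tr+(1-t)s)\ge\min\{\tilde a(r),\tilde a(s)\}$ for all $r,s\in\mathbb{R}$, $t\in[0,1]$; (iii) $\tilde a$ is upper semicontinuous; (iv) the closure of $\{r:\tilde a(r)>0\}$ is compact. $F(\mathbb{R})$ is the set of all fuzzy numbers. For $\alpha\in(0,1]$ the $\alpha$-level set is $\tilde a_\alpha=\{r:\tilde a(r)\ge\alpha\}$, and $\tilde a_0$ is the closure of $\{r:\tilde a(r)>0\}$; each is a compact interval written $\tilde a_\alpha=[\tilde a_\alpha^L,\tilde a_\alpha^U]$. A fuzzy number is determined by its level sets. Arithmetic. For $\alpha\in[0,1]$: $(\tilde a\oplus\tilde b)_\alpha=[\tilde a_\alpha^L+\tilde b_\alpha^L,\tilde a_\alpha^U+\tilde b_\alpha^U]$; for $\lambda\in\mathbb{R}$, $(\lambda\odot\tilde a)_\alpha=[\lambda\tilde a_\alpha^L,\lambda\tilde a_\alpha^U]$ if $\lambda\ge0$ and $[\lambda\tilde a_\alpha^U,\lambda\tilde a_\alpha^L]$ if $\lambda<0$. Order. The linear order relation is: $\tilde a\preceq\tilde b$ means $\int_0^1\alpha[\tilde a_\alpha^L+\tilde a_\alpha^U]\,d\alpha\le\int_0^1\alpha[\tilde b_\alpha^L+\tilde b_\alpha^U]\,d\alpha$, and $\tilde a\prec\tilde b$ means $\int_0^1\alpha[\tilde a_\alpha^L+\tilde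 a_\alpha^U]\,d\alpha<\int_0^1\alpha[\tilde b_\alpha^L+\tilde b_\alpha^U]\,d\alpha$. Metric. $d_F(\tilde a,\tilde b)=\sup_{0\le\alpha\le1}\max\{|\tilde a_\alpha^L-\tilde b_\alpha^L|,|\tilde a_\alpha^U-\tilde b_\alpha^U|\}$. Limits and continuity of fuzzy-valued functions are with respect to $d_F$. Level functions. For $\tilde f:X\to F(\mathbb{R})$ and $\alpha\in[0,1]$, $\tilde f_\alpha^L(\bar x)=(\tilde f(\bar x))_\alpha^L$ and $\tilde f_\alpha^U(\bar x)=(\tilde f(\bar x))_\alpha^U$. gH-difference. $\tilde a\ominus_{gH}\tilde b$ is the fuzzy number $\tilde c$, if it exists, such that $\tilde a=\tilde b\oplus\tilde c$ or $\tilde b=\tilde a\oplus((-1)\odot\tilde c)$. Its level sets are $[\min\{\tilde a_\alpha^L-\tilde b_\alpha^L,\tilde a_\alpha^U-\tilde b_\alpha^U\},\max\{\tilde a_\alpha^L-\tilde b_\alpha^L,\tilde a_\alpha^U-\tilde b_\alpha^U\}]$. gH-differentiability in one variable. For an open interval $I$, $\tilde g:I\to F(\mathbb{R})$ is gH-differentiable at $x_0\in I$ with gH-derivative $\tilde g'_{gH}(x_0)\in F(\mathbb{R})$ if $\tilde g'_{gH}(x_0)=\lim_{h\to0}\frac1h\odot\big(\tilde g(x_0+h)\ominus_{gH}\tilde g(x_0)\big)$ exists in $F(\mathbb{R})$. gH-differentiability in several variables. For $X\subseteq\mathbb{R}^n$ open, $\tilde f:X\to F(\mathbb{R})$ has $i$-th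 partial gH-derivative $D_i\tilde f(\bar x^0)=\frac{\partial\tilde f}{\partial x_i}(\bar x^0)$ at $\bar x^0\in X$ if the function $x_i\mapsto\tilde f(x_1^0,\dots,x_{i-1}^0,x_i,x_{i+1}^0,\dots,x_n^0)$ is gH-differentiable at $x_i^0$ with that gH-derivative. $\tilde f$ is gH-differentiable at $\bar x^0$ if one of the partial gH-derivatives exists at $\bar x^0$ and the remaining $n-1$ exist on some neighborhood of $\bar x^0$ and are continuous at $\bar x^0$. $\tilde f$ is gH-differentiable on $X$ if it is so at every point of $X$; its gradient is then $\nabla\tilde f=(D_1\tilde f,\dots,D_n\tilde f)$. Second order. $\tilde f$ is twice gH-differentiable at $\bar x^0$ if $\nabla\tilde f$ is gH-differentiable at $\bar x^0$, i.e. each $D_i\tilde f:X\to F(\mathbb{R})$ is gH-differentiable at $\bar x^0$; $\frac{\partial^2\tilde f}{\partial x_i\partial x_j}(\bar x^0)\in F(\mathbb{R})$ denotes the partial gH-derivative of $D_i\tilde f$ in the direction of the $j$-th coordinate vector at $\bar x^0$. $\tilde f$ is twice continuously gH-differentiable on $X$ if it is twice gH-differentiable at every point of $X$ and, for all $i,j=1,\dots,n$, $\frac{\partial^2\tilde f}{\partial x_i\partial x_j}:X\to F(\mathbb{R})$ is continuous. Strict local minimizer. $\bar x^*\in X$ is a strict local minimizer if there is $\epsilon>0$ such that $\tilde f(\bar x^* )\prec\tilde f(\bar x)$ for all $\bar x\in X$ with $0<\|\bar x-\bar x^*\|<\epsilon$. *)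

theory Defs
  imports "HOL-Analysis.Analysis"
begin

section \<open>Fuzzy numbers\<close>

definition upper_semicontinuous :: "(real \<Rightarrow> real) \<Rightarrow> bool" where
  "upper_semicontinuous a \<longleftrightarrow> (\<forall>r. \<forall>y > a r. \<forall>\<^sub>F s in nhds r. a s < y)"

definition is_fuzzy_number :: "(real \<Rightarrow> real) \<Rightarrow> bool" where
  "is_fuzzy_number a \<longleftrightarrow>
     range a \<subseteq> {0..1} \<and>
     (\<exists>r. a r = 1) \<and>
     (\<forall>r s. \<forall>t\<in>{0..1}. a (t * r + (1 - t) * s) \<ge> min (a r) (a s)) \<and>
     upper_semicontinuous a \<and>
     compact (closure {r. a r > 0})"

typedef fuzzy = "{a. is_fuzzy_number a}"
  morphisms membership Abs_fuzzy
proof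
  show "(\<lambda>r. if r = 0 then 1 else 0) \<in> {a. is_fuzzy_number a}"
  proof -
    have "upper_semicontinuous (\<lambda>r::real. if r = 0 then 1 else 0)"
      unfolding upper_semicontinuous_def
    proof (intro allI impI)
      fix r y :: real assume y: "(if r = 0 then 1 else 0) < y"
      show "\<forall>\<^sub>F s in nhds r. (if s = 0 then 1 else 0) < y"
      proof (cases "r = 0")
        case True
        then show ?thesis using y by (auto intro!: always_eventually)
      next
        case False
        have "\<forall>\<^sub>F s in nhds r. s \<in> - {0}"
          by (rule eventually_nhds_in_open) (use False in auto)
        then show ?thesis by eventually_elim (use y False in auto)
      qed
    qed
    moreover have "{r::real. (if r = 0 then 1 else 0::real) > 0} = {0}" by auto
    then have "compact (closure {r::real. (if r = 0 then 1 else 0::real) > 0})" by simp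
    moreover have "min (if r = 0 then 1 else 0) (if s = 0 then 1 else 0)
        \<le> (if t * r + (1 - t) * s = 0 then 1 else 0 :: real)" for r s t :: real
      by (cases "r = 0"; cases "s = 0"; simp)
    moreover have "range (\<lambda>r::real. if r = 0 then 1 else 0 :: real) \<subseteq> {0..1}" by auto
    moreover have "\<exists>r::real. (if r = 0 then 1 else 0 :: real) = 1" by (rule exI[of _ 0]) simp
    ultimately show ?thesis
      unfolding is_fuzzy_number_def mem_Collect_eq by blast
  qed
qed

definition level :: "fuzzy \<Rightarrow> real \<Rightarrow> real set" where
  "level a \<alpha> = (if \<alpha> = 0 then closure {r. membership a r > 0}
                else {r. membership a r \<ge> \<alpha>})"

definition lower :: "fuzzy \<Rightarrow> real \<Rightarrow> real" where
  "lower a \<alpha> = Inf (level a \<alpha>)"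

definition upper :: "fuzzy \<Rightarrow> real \<Rightarrow> real" where
  "upper a \<alpha> = Sup (level a \<alpha>)"

lemma membership_props:
  shows membership_ge0: "0 \<le> membership a r"
    and membership_le1: "membership a r \<le> 1"
    and membership_normal: "\<exists>r. membership a r = 1"
    and membership_quasiconcave:
      "t \<in> {0..1} \<Longrightarrow> min (membership a r) (membership a s) \<le> membership a (t * r + (1 - t) * s)"
    and membership_usc: "upper_semicontinuous (membership a)"
    and membership_compact: "compact (closure {r. membership a r > 0})"
  using membership[of a] by (auto simp: is_fuzzy_number_def image_subset_iff)

lemma convex_superlevel: "convex {r. membership a r \<ge> \<alpha>}" "convex {r. membership a r > \<alpha>}"
proof -
  have *: "min (membership a x) (membership a y) \<le> membership a (u * x + v * y)"
    if "0 \<le> u" "0 \<le> v" "u + v = 1" for u v x y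
  proof -
    have v: "v = 1 - u" using that by simp
    show ?thesis unfolding v using membership_quasiconcave[of u a x y] that by simp
  qed
  show "convex {r. membership a r \<ge> \<alpha>}"
  proof (rule convexI)
    fix x y u v :: real
    assume "x \<in> {r. membership a r \<ge> \<alpha>}" "y \<in> {r. membership a r \<ge> \<alpha>}" "0 \<le> u" "0 \<le> v" "u + v = 1"
    with *[of u v x y] show "u *\<^sub>R x + v *\<^sub>R y \<in> {r. membership a r \<ge> \<alpha>}" by auto
  qed
  show "convex {r. membership a r > \<alpha>}"
  proof (rule convexI)
    fix x y u v :: real
    assume "x \<in> {r. membership a r > \<alpha>}" "y \<in> {r. membership a r > \<alpha>}" "0 \<le> u" "0 \<le> v" "u + v = 1"
    with *[of u v x y] show "u *\<^sub>R x + v *\<^sub>R y \<in> {r. membership a r > \<alpha>}" by auto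
  qed
qed

lemma closed_superlevel: "closed {r. membership a r \<ge> \<alpha>}"
proof -
  have "open {r. membership a r < \<alpha>}"
    unfolding open_subopen[of "{r. membership a r < \<alpha>}"]
  proof
    fix r assume "r \<in> {r. membership a r < \<alpha>}"
    then have "\<forall>\<^sub>F s in nhds r. membership a s < \<alpha>"
      using membership_usc[of a] by (auto simp: upper_semicontinuous_def)
    then show "\<exists>T. open T \<and> r \<in> T \<and> T \<subseteq> {r. membership a r < \<alpha>}"
      by (auto simp: eventually_nhds)
  qed
  moreover have "- {r. membership a r \<ge> \<alpha>} = {r. membership a r < \<alpha>}" by auto
  ultimately show ?thesis by (simp add: closed_def)
qed

lemma level_antimono:
  assumes "0 \<le> \<alpha>" "\<alpha> \<le> \<beta>"
  shows "level a \<beta> \<subseteq> level a \<alpha>"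
proof -
  have "{r. membership a r \<ge> \<beta>} \<subseteq> closure {r. membership a r > 0}" if "\<beta> > 0"
    using that closure_subset[of "{r. membership a r > 0}"] by force
  then show ?thesis using assms by (auto simp: level_def)
qed

lemma level_nonempty:
  assumes "\<alpha> \<in> {0..1}"
  shows "level a \<alpha> \<noteq> {}"
proof -
  obtain r where "membership a r = 1" using membership_normal by blast
  then have "r \<in> level a 1" by (simp add: level_def)
  then show ?thesis using level_antimono[of \<alpha> 1 a] assms by auto
qed

lemma level_eq:
  assumes "\<alpha> \<in> {0..1}"
  shows "level a \<alpha> = {lower a \<alpha>..upper a \<alpha>}" and "lower a \<alpha> \<le> upper a \<alpha>"
proof -
  have c0: "compact (level a 0)"
    using membership_compact by (simp add: level_def)
  have "closed (level a \<alpha>)"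
    by (simp add: level_def closed_superlevel)
  moreover have "bounded (level a \<alpha>)"
    using level_antimono[of 0 \<alpha> a] assms c0 bounded_subset compact_imp_bounded by auto
  ultimately have "compact (level a \<alpha>)"
    by (simp add: compact_eq_bounded_closed)
  moreover have "connected (level a \<alpha>)"
    by (intro convex_connected) (auto simp: level_def convex_superlevel intro!: convex_closure)
  ultimately obtain l u where lu: "level a \<alpha> = {l..u}"
    using connected_compact_interval_1[of "level a \<alpha>"] by auto
  then have "l \<le> u" using level_nonempty[OF assms, of a] by auto
  then show "level a \<alpha> = {lower a \<alpha>..upper a \<alpha>}" "lower a \<alpha> \<le> upper a \<alpha>"
    unfolding lower_def upper_def lu by auto
qed

lemma fuzzy_eqI:
  assumes "\<And>\<alpha>. \<alpha> \<in> {0..1} \<Longrightarrow> level a \<alpha> = level b \<alpha>"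
  shows "a = b"
proof -
  have *: "membership a r \<ge> membership b r"
    if "\<And>\<alpha>. \<alpha> \<in> {0..1} \<Longrightarrow> level a \<alpha> = level b \<alpha>" for a b r
  proof (cases "membership b r = 0")
    case True
    then show ?thesis by (simp add: membership_ge0)
  next
    case False
    then have "r \<in> level b (membership b r)" by (simp add: level_def)
    also have "\<dots> = level a (membership b r)"
      using that[of "membership b r"] membership_ge0[of b r] membership_le1[of b r] by simp
    finally show ?thesis using False by (simp add: level_def)
  qed
  have "membership a = membership b"
    using *[of a b] *[of b a] assms by (intro ext antisym) auto
  then show ?thesis by (simp add: membership_inject)
qed

lemma fuzzy_eqI_ends:
  assumes "\<And>\<alpha>. \<alpha> \<in> {0..1} \<Longrightarrow> lower a \<alpha> = lower b \<alpha>"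
    and "\<And>\<alpha>. \<alpha> \<in> {0..1} \<Longrightarrow> upper a \<alpha> = upper b \<alpha>"
  shows "a = b"
  using assms by (intro fuzzy_eqI) (simp add: level_eq)

lemma lower_mono:
  assumes "0 \<le> \<alpha>" "\<alpha> \<le> \<beta>" "\<beta> \<le> 1"
  shows "lower a \<alpha> \<le> lower a \<beta>"
  using level_antimono[of \<alpha> \<beta> a] level_eq[of \<alpha> a] level_eq[of \<beta> a] assms by auto

lemma upper_antimono:
  assumes "0 \<le> \<alpha>" "\<alpha> \<le> \<beta>" "\<beta> \<le> 1"
  shows "upper a \<beta> \<le> upper a \<alpha>"
  using level_antimono[of \<alpha> \<beta> a] level_eq[of \<alpha> a] level_eq[of \<beta> a] assms by auto

lemma lower_upper_bounds:
  assumes "\<alpha> \<in> {0..1}"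
  shows "lower a 0 \<le> lower a \<alpha>" "lower a \<alpha> \<le> upper a 0"
    "lower a 0 \<le> upper a \<alpha>" "upper a \<alpha> \<le> upper a 0"
  using lower_mono[of 0 \<alpha> a] upper_antimono[of 0 \<alpha> a] level_eq(2)[of \<alpha> a] assms by auto

section \<open>The supremum metric\<close>

instantiation fuzzy :: metric_space
begin

definition dist_fuzzy :: "fuzzy \<Rightarrow> fuzzy \<Rightarrow> real" where
  "dist a b = (SUP \<alpha>\<in>{0..1}. max \<bar>lower a \<alpha> - lower b \<alpha>\<bar> \<bar>upper a \<alpha> - upper b \<alpha>\<bar>)"

definition uniformity_fuzzy :: "(fuzzy \<times> fuzzy) filter" where
  "uniformity_fuzzy = (INF e\<in>{0 <..}. principal {(x, y). dist x y < e})"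

definition open_fuzzy :: "fuzzy set \<Rightarrow> bool" where
  "open_fuzzy U \<longleftrightarrow> (\<forall>x\<in>U. \<forall>\<^sub>F (x', y) in uniformity. x' = x \<longrightarrow> y \<in> U)"

lemma fuzzy_dist_bdd:
  "bdd_above ((\<lambda>\<alpha>. max \<bar>lower a \<alpha> - lower b \<alpha>\<bar> \<bar>upper a \<alpha> - upper b \<alpha>\<bar>) ` {0..1})"
proof (rule bdd_aboveI2)
  fix \<alpha> :: real assume \<alpha>: "\<alpha> \<in> {0..1}"
  show "max \<bar>lower a \<alpha> - lower b \<alpha>\<bar> \<bar>upper a \<alpha> - upper b \<alpha>\<bar>
     \<le> \<bar>upper a 0\<bar> + \<bar>lower a 0\<bar> + \<bar>upper b 0\<bar> + \<bar>lower b 0\<bar>"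
    using lower_upper_bounds[OF \<alpha>, of a] lower_upper_bounds[OF \<alpha>, of b] by linarith
qed

lemma fuzzy_dist_upper:
  assumes "\<alpha> \<in> {0..1}"
  shows "\<bar>lower a \<alpha> - lower b \<alpha>\<bar> \<le> dist a b" "\<bar>upper a \<alpha> - upper b \<alpha>\<bar> \<le> dist a b"
  using cSUP_upper[OF assms fuzzy_dist_bdd[of a b]] by (auto simp: dist_fuzzy_def)

lemma fuzzy_dist_least:
  assumes "\<And>\<alpha>. \<alpha> \<in> {0..1} \<Longrightarrow> \<bar>lower a \<alpha> - lower b \<alpha>\<bar> \<le> e"
    and "\<And>\<alpha>. \<alpha> \<in> {0..1} \<Longrightarrow> \<bar>upper a \<alpha> - upper b \<alpha>\<bar> \<le> e"
  shows "dist a b \<le> e"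
  unfolding dist_fuzzy_def by (rule cSUP_least) (use assms in auto)

instance
proof
  fix a b c :: fuzzy
  show "(dist a b = 0) = (a = b)"
  proof
    assume "dist a b = 0"
    then show "a = b"
      using fuzzy_dist_upper[of _ a b] by (intro fuzzy_eqI_ends) auto
  next
    assume "a = b"
    then show "dist a b = 0"
      by (simp add: dist_fuzzy_def)
  qed
  show "dist a b \<le> dist a c + dist b c"
  proof (rule fuzzy_dist_least)
    fix \<alpha> :: real assume \<alpha>: "\<alpha> \<in> {0..1}"
    show "\<bar>lower a \<alpha> - lower b \<alpha>\<bar> \<le> dist a c + dist b c"
      using fuzzy_dist_upper(1)[OF \<alpha>, of a c] fuzzy_dist_upper(1)[OF \<alpha>, of b c] by linarith
    show "\<bar>upper a \<alpha> - upper b \<alpha>\<bar> \<le> dist a c + dist b c"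
      using fuzzy_dist_upper(2)[OF \<alpha>, of a c] fuzzy_dist_upper(2)[OF \<alpha>, of b c] by linarith
  qed
qed (simp_all add: uniformity_fuzzy_def open_fuzzy_def)

end

section \<open>Arithmetic through level sets\<close>

definition fuzzy_of_levels :: "(real \<Rightarrow> real) \<Rightarrow> (real \<Rightarrow> real) \<Rightarrow> fuzzy" where
  "fuzzy_of_levels L U = (THE c. \<forall>\<alpha>\<in>{0..1}. level c \<alpha> = {L \<alpha>..U \<alpha>})"

definition fuzzy_add :: "fuzzy \<Rightarrow> fuzzy \<Rightarrow> fuzzy"  (infixl \<open>\<oplus>\<^sub>F\<close> 65) where
  "a \<oplus>\<^sub>F b = fuzzy_of_levels (\<lambda>\<alpha>. lower a \<alpha> + lower b \<alpha>) (\<lambda>\<alpha>. upper a \<alpha> + upper b \<alpha>)"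

definition fuzzy_scale :: "real \<Rightarrow> fuzzy \<Rightarrow> fuzzy"  (infixr \<open>\<odot>\<^sub>F\<close> 75) where
  "c \<odot>\<^sub>F a = (if c \<ge> 0 then fuzzy_of_levels (\<lambda>\<alpha>. c * lower a \<alpha>) (\<lambda>\<alpha>. c * upper a \<alpha>)
             else fuzzy_of_levels (\<lambda>\<alpha>. c * upper a \<alpha>) (\<lambda>\<alpha>. c * lower a \<alpha>))"

text \<open>
  The description in \<open>fuzzy_of_levels\<close> is proper for every family of intervals that is nested,
  left-continuous on \<open>(0,1]\<close> and right-continuous at \<open>0\<close>; the families used in the two
  operations above are of this kind.
\<close>

lemma level_family_membership:
  fixes L U :: "real \<Rightarrow> real"
  assumes L: "\<And>\<alpha> \<beta>. 0 \<le> \<alpha> \<Longrightarrow> \<alpha> \<le> \<beta> \<Longrightarrow> \<beta> \<le> 1 \<Longrightarrow> L \<alpha> \<le> L \<beta>"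
    and U: "\<And>\<alpha> \<beta>. 0 \<le> \<alpha> \<Longrightarrow> \<alpha> \<le> \<beta> \<Longrightarrow> \<beta> \<le> 1 \<Longrightarrow> U \<beta> \<le> U \<alpha>"
    and Ll: "\<And>\<alpha>. 0 < \<alpha> \<Longrightarrow> \<alpha> \<le> 1 \<Longrightarrow> (L \<longlongrightarrow> L \<alpha>) (at_left \<alpha>)"
    and Ul: "\<And>\<alpha>. 0 < \<alpha> \<Longrightarrow> \<alpha> \<le> 1 \<Longrightarrow> (U \<longlongrightarrow> U \<alpha>) (at_left \<alpha>)"
    and \<alpha>: "0 < \<alpha>" "\<alpha> \<le> 1"
  shows "Sup (insert 0 {\<beta>\<in>{0..1}. L \<beta> \<le> r \<and> r \<le> U \<beta>}) \<ge> \<alpha> \<longleftrightarrow> L \<alpha> \<le> r \<and> r \<le> U \<alpha>"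
    (is "Sup ?S \<ge> \<alpha> \<longleftrightarrow> _")
proof
  have bdd: "bdd_above ?S" by (rule bdd_aboveI[of _ 1]) auto
  {
    assume "L \<alpha> \<le> r \<and> r \<le> U \<alpha>"
    then show "\<alpha> \<le> Sup ?S" using \<alpha> bdd by (intro cSup_upper) auto
  }
  assume *: "\<alpha> \<le> Sup ?S"
  have **: "L \<beta> \<le> r \<and> r \<le> U \<beta>" if \<beta>: "0 < \<beta>" "\<beta> < \<alpha>" for \<beta>
  proof -
    have "\<beta> < Sup ?S" using * \<beta> by simp
    then obtain \<gamma> where "\<gamma> \<in> ?S" "\<beta> < \<gamma>"
      using less_cSup_iff[OF _ bdd] by blast
    then show ?thesis using \<beta> L[of \<beta> \<gamma>] U[of \<beta> \<gamma>] by auto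
  qed
  have ev: "\<forall>\<^sub>F \<beta> in at_left \<alpha>. 0 < \<beta> \<and> \<beta> < \<alpha>"
    using eventually_at_left_real[OF \<alpha>(1)] by eventually_elim auto
  show "L \<alpha> \<le> r \<and> r \<le> U \<alpha>"
  proof
    show "L \<alpha> \<le> r"
      by (rule tendsto_upperbound[OF Ll[OF \<alpha>]]) (use ev ** in \<open>auto elim: eventually_mono\<close>)
    show "r \<le> U \<alpha>"
      by (rule tendsto_lowerbound[OF Ul[OF \<alpha>]]) (use ev ** in \<open>auto elim: eventually_mono\<close>)
  qed
qed

lemma fuzzy_of_levels:
  fixes L U :: "real \<Rightarrow> real"
  assumes L: "\<And>\<alpha> \<beta>. 0 \<le> \<alpha> \<Longrightarrow> \<alpha> \<le> \<beta> \<Longrightarrow> \<beta> \<le> 1 \<Longrightarrow> L \<alpha> \<le> L \<beta>"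
    and U: "\<And>\<alpha> \<beta>. 0 \<le> \<alpha> \<Longrightarrow> \<alpha> \<le> \<beta> \<Longrightarrow> \<beta> \<le> 1 \<Longrightarrow> U \<beta> \<le> U \<alpha>"
    and LU: "L 1 \<le> U 1"
    and Ll: "\<And>\<alpha>. 0 < \<alpha> \<Longrightarrow> \<alpha> \<le> 1 \<Longrightarrow> (L \<longlongrightarrow> L \<alpha>) (at_left \<alpha>)"
    and Ul: "\<And>\<alpha>. 0 < \<alpha> \<Longrightarrow> \<alpha> \<le> 1 \<Longrightarrow> (U \<longlongrightarrow> U \<alpha>) (at_left \<alpha>)"
    and L0: "(L \<longlongrightarrow> L 0) (at_right 0)"
    and U0: "(U \<longlongrightarrow> U 0) (at_right 0)"
    and \<alpha>: "\<alpha> \<in> {0..1}"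
  shows "level (fuzzy_of_levels L U) \<alpha> = {L \<alpha>..U \<alpha>}"
    and "lower (fuzzy_of_levels L U) \<alpha> = L \<alpha>"
    and "upper (fuzzy_of_levels L U) \<alpha> = U \<alpha>"
proof -
  define m where "m r = Sup (insert 0 {\<beta>\<in>{0..1}. L \<beta> \<le> r \<and> r \<le> U \<beta>})" for r
  have m_ge: "m r \<ge> \<beta> \<longleftrightarrow> L \<beta> \<le> r \<and> r \<le> U \<beta>" if "0 < \<beta>" "\<beta> \<le> 1" for r \<beta>
    unfolding m_def using level_family_membership[OF L U Ll Ul] that by blast
  have m0: "0 \<le> m r" for r
    unfolding m_def by (intro cSup_upper bdd_aboveI[of _ 1]) auto
  have m1: "m r \<le> 1" for r
    unfolding m_def by (intro cSup_least) auto
  have LUb: "L \<beta> \<le> U \<beta>" if "0 \<le> \<beta>" "\<beta> \<le> 1" for \<beta>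
    using L[of \<beta> 1] U[of \<beta> 1] LU that by linarith
  have cl: "closure {r. m r > 0} = {L 0..U 0}"
  proof
    have "{r. m r > 0} \<subseteq> {L 0..U 0}"
    proof
      fix r assume "r \<in> {r. m r > 0}"
      then have "m r > 0" by simp
      then have "L (m r) \<le> r" "r \<le> U (m r)" using m_ge[of "m r" r] m1[of r] by auto
      then show "r \<in> {L 0..U 0}"
        using L[of 0 "m r"] U[of 0 "m r"] m0[of r] m1[of r] by auto
    qed
    then show "closure {r. m r > 0} \<subseteq> {L 0..U 0}"
      by (rule closure_minimal) simp
    show "{L 0..U 0} \<subseteq> closure {r. m r > 0}"
    proof
      fix r assume r: "r \<in> {L 0..U 0}"
      have "((\<lambda>\<beta>. max (L \<beta>) (min (U \<beta>) r)) \<longlongrightarrow> max (L 0) (min (U 0) r)) (at_right 0)"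
        by (intro tendsto_max tendsto_min L0 U0 tendsto_const)
      moreover have "max (L 0) (min (U 0) r) = r" using r by auto
      moreover have "\<forall>\<^sub>F \<beta> in at_right 0. max (L \<beta>) (min (U \<beta>) r) \<in> closure {r. m r > 0}"
        using eventually_at_right_real[of 0 "1::real", simplified]
      proof eventually_elim
        case (elim \<beta>)
        then have "m (max (L \<beta>) (min (U \<beta>) r)) \<ge> \<beta>"
          using m_ge[of \<beta>] LUb[of \<beta>] by auto
        then show ?case using elim closure_subset[of "{r. m r > 0}"] by auto
      qed
      ultimately show "r \<in> closure {r. m r > 0}"
        by (intro Lim_in_closed_set[of "closure {r. m r > 0}" _ "at_right 0"]) auto
    qed
  qed
  have "is_fuzzy_number m"
    unfolding is_fuzzy_number_def
  proof (intro conjI allI ballI)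
    show "range m \<subseteq> {0..1}" using m0 m1 by auto
    have "m (L 1) \<ge> 1" using m_ge[of 1 "L 1"] LU by simp
    then show "\<exists>r. m r = 1" using m1[of "L 1"] by (intro exI[of _ "L 1"]) simp
    show "compact (closure {r. m r > 0})" by (simp add: cl)
    show "upper_semicontinuous m"
      unfolding upper_semicontinuous_def
    proof (intro allI impI)
      fix r y assume y: "m r < y"
      show "\<forall>\<^sub>F s in nhds r. m s < y"
      proof (cases "y > 1")
        case True
        then show ?thesis using m1 by (intro always_eventually allI) (meson le_less_trans)
      next
        case False
        then have y01: "0 < y" "y \<le> 1" using y m0[of r] by auto
        have "\<forall>\<^sub>F s in nhds r. s \<in> - {L y..U y}"
          using y m_ge[OF y01, of r] by (intro eventually_nhds_in_open) (auto simp: open_Compl)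
        then show ?thesis
          by eventually_elim (use m_ge[OF y01] in \<open>auto simp: not_le[symmetric]\<close>)
      qed
    qed
    fix r s t :: real assume t: "t \<in> {0..1}"
    show "min (m r) (m s) \<le> m (t * r + (1 - t) * s)"
    proof (cases "min (m r) (m s) > 0")
      case False
      then show ?thesis using m0 by (meson not_less order_trans)
    next
      case True
      define \<beta> where "\<beta> = min (m r) (m s)"
      have \<beta>: "0 < \<beta>" "\<beta> \<le> 1" using True m1[of r] by (auto simp: \<beta>_def)
      have "r \<in> {L \<beta>..U \<beta>}" "s \<in> {L \<beta>..U \<beta>}"
        using m_ge[OF \<beta>, of r] m_ge[OF \<beta>, of s] by (auto simp: \<beta>_def)
      then have "t *\<^sub>R r + (1 - t) *\<^sub>R s \<in> {L \<beta>..U \<beta>}"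
        using t by (intro convexD[OF convex_real_interval(5)]) auto
      then show ?thesis using m_ge[OF \<beta>] by (simp add: \<beta>_def)
    qed
  qed
  then have mem: "membership (Abs_fuzzy m) = m" by (simp add: Abs_fuzzy_inverse)
  have lev: "\<forall>\<beta>\<in>{0..1}. level (Abs_fuzzy m) \<beta> = {L \<beta>..U \<beta>}"
    using m_ge by (auto simp: level_def mem cl)
  have "\<forall>\<beta>\<in>{0..1}. level (fuzzy_of_levels L U) \<beta> = {L \<beta>..U \<beta>}"
    unfolding fuzzy_of_levels_def
  proof (rule theI[where a = "Abs_fuzzy m"])
    show "c = Abs_fuzzy m" if "\<forall>\<beta>\<in>{0..1}. level c \<beta> = {L \<beta>..U \<beta>}" for c
      using that lev by (intro fuzzy_eqI) auto
  qed (rule lev)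
  then show *: "level (fuzzy_of_levels L U) \<alpha> = {L \<alpha>..U \<alpha>}" using \<alpha> by blast
  show "lower (fuzzy_of_levels L U) \<alpha> = L \<alpha>" "upper (fuzzy_of_levels L U) \<alpha> = U \<alpha>"
    using LUb[of \<alpha>] \<alpha> by (simp_all add: lower_def upper_def *)
qed

lemma lower_left_continuous:
  assumes \<alpha>: "0 < \<alpha>" "\<alpha> \<le> 1"
  shows "(lower a \<longlongrightarrow> lower a \<alpha>) (at_left \<alpha>)"
proof (rule order_tendstoI)
  have ev: "\<forall>\<^sub>F \<beta> in at_left \<alpha>. 0 < \<beta> \<and> \<beta> < \<alpha>"
    using eventually_at_left_real[OF \<alpha>(1)] by eventually_elim auto
  fix y
  {
    assume "lower a \<alpha> < y"
    then show "\<forall>\<^sub>F \<beta> in at_left \<alpha>. lower a \<beta> < y"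
      using ev by (auto elim!: eventually_mono) (metis \<alpha>(2) lower_mono order_le_less_trans less_imp_le)
  }
  assume y: "y < lower a \<alpha>"
  have "\<exists>\<beta>>0. \<beta> < \<alpha> \<and> y < lower a \<beta>"
  proof (rule ccontr)
    assume *: "\<not> ?thesis"
    have "\<beta> \<le> membership a y" if "0 < \<beta>" "\<beta> < \<alpha>" for \<beta>
    proof -
      have "lower a \<beta> \<le> y" using * that by (meson not_le)
      moreover have "y \<le> upper a \<beta>"
        using y level_eq(2)[of \<alpha> a] upper_antimono[of \<beta> \<alpha> a] that \<alpha> by auto
      ultimately have "y \<in> level a \<beta>" using level_eq(1)[of \<beta> a] that \<alpha> by auto
      then show ?thesis using that by (simp add: level_def)
    qed
    then have "\<alpha> \<le> membership a y"
      using dense_le_bounded[OF \<alpha>(1)] by blast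
    then have "y \<in> level a \<alpha>" using \<alpha> by (simp add: level_def)
    then show False using y level_eq(1)[of \<alpha> a] \<alpha> by auto
  qed
  then obtain \<beta> where \<beta>: "0 < \<beta>" "\<beta> < \<alpha>" "y < lower a \<beta>" by blast
  show "\<forall>\<^sub>F \<beta> in at_left \<alpha>. y < lower a \<beta>"
    using eventually_at_left_real[OF \<beta>(2)]
  proof eventually_elim
    case (elim \<gamma>)
    then show ?case using \<beta> \<alpha> lower_mono[of \<beta> \<gamma> a] by auto
  qed
qed

lemma upper_left_continuous:
  assumes \<alpha>: "0 < \<alpha>" "\<alpha> \<le> 1"
  shows "(upper a \<longlongrightarrow> upper a \<alpha>) (at_left \<alpha>)"
proof (rule order_tendstoI)
  have ev: "\<forall>\<^sub>F \<beta> in at_left \<alpha>. 0 < \<beta> \<and> \<beta> < \<alpha>"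
    using eventually_at_left_real[OF \<alpha>(1)] by eventually_elim auto
  fix y
  {
    assume "y < upper a \<alpha>"
    then show "\<forall>\<^sub>F \<beta> in at_left \<alpha>. y < upper a \<beta>"
      using ev by (auto elim!: eventually_mono) (metis \<alpha>(2) upper_antimono order_less_le_trans less_imp_le)
  }
  assume y: "upper a \<alpha> < y"
  have "\<exists>\<beta>>0. \<beta> < \<alpha> \<and> upper a \<beta> < y"
  proof (rule ccontr)
    assume *: "\<not> ?thesis"
    have "\<beta> \<le> membership a y" if "0 < \<beta>" "\<beta> < \<alpha>" for \<beta>
    proof -
      have "y \<le> upper a \<beta>" using * that by (meson not_le)
      moreover have "lower a \<beta> \<le> y"
        using y level_eq(2)[of \<alpha> a] lower_mono[of \<beta> \<alpha> a] that \<alpha> by auto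
      ultimately have "y \<in> level a \<beta>" using level_eq(1)[of \<beta> a] that \<alpha> by auto
      then show ?thesis using that by (simp add: level_def)
    qed
    then have "\<alpha> \<le> membership a y"
      using dense_le_bounded[OF \<alpha>(1)] by blast
    then have "y \<in> level a \<alpha>" using \<alpha> by (simp add: level_def)
    then show False using y level_eq(1)[of \<alpha> a] \<alpha> by auto
  qed
  then obtain \<beta> where \<beta>: "0 < \<beta>" "\<beta> < \<alpha>" "upper a \<beta> < y" by blast
  show "\<forall>\<^sub>F \<beta> in at_left \<alpha>. upper a \<beta> < y"
    using eventually_at_left_real[OF \<beta>(2)]
  proof eventually_elim
    case (elim \<gamma>)
    then show ?case using \<beta> \<alpha> upper_antimono[of \<beta> \<gamma> a] by auto
  qed
qed

lemma support_near:
  assumes "open T" "x \<in> T" "x \<in> level a 0"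
  obtains s where "s \<in> T" "0 < membership a s"
  using assms open_Int_closure_eq_empty[of T "{r. membership a r > 0}"]
  by (auto simp: level_def)

lemma lower_right_continuous_0: "(lower a \<longlongrightarrow> lower a 0) (at_right 0)"
proof (rule order_tendstoI)
  fix y
  {
    assume y: "y < lower a 0"
    show "\<forall>\<^sub>F \<beta> in at_right 0. y < lower a \<beta>"
      using eventually_at_right_real[of 0 "1::real", simplified]
    proof eventually_elim
      case (elim \<beta>)
      then show ?case using y lower_mono[of 0 \<beta> a] by auto
    qed
  }
  assume y: "lower a 0 < y"
  obtain s where s: "s < y" "0 < membership a s"
    using support_near[of "{..<y}" "lower a 0" a] level_eq[of 0 a] y by auto
  show "\<forall>\<^sub>F \<beta> in at_right 0. lower a \<beta> < y"
    using eventually_at_right_real[OF s(2)]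
  proof eventually_elim
    case (elim \<beta>)
    then have "s \<in> level a \<beta>" by (simp add: level_def)
    then show ?case using level_eq(1)[of \<beta> a] elim membership_le1[of a s] s by auto
  qed
qed

lemma upper_right_continuous_0: "(upper a \<longlongrightarrow> upper a 0) (at_right 0)"
proof (rule order_tendstoI)
  fix y
  {
    assume y: "upper a 0 < y"
    show "\<forall>\<^sub>F \<beta> in at_right 0. upper a \<beta> < y"
      using eventually_at_right_real[of 0 "1::real", simplified]
    proof eventually_elim
      case (elim \<beta>)
      then show ?case using y upper_antimono[of 0 \<beta> a] by auto
    qed
  }
  assume y: "y < upper a 0"
  obtain s where s: "y < s" "0 < membership a s"
    using support_near[of "{y<..}" "upper a 0" a] level_eq[of 0 a] y by auto
  show "\<forall>\<^sub>F \<beta> in at_right 0. y < upper a \<beta>"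
    using eventually_at_right_real[OF s(2)]
  proof eventually_elim
    case (elim \<beta>)
    then have "s \<in> level a \<beta>" by (simp add: level_def)
    then show ?case using level_eq(1)[of \<beta> a] elim membership_le1[of a s] s by auto
  qed
qed

lemma fuzzy_add_ends:
  assumes "\<alpha> \<in> {0..1}"
  shows "lower (a \<oplus>\<^sub>F b) \<alpha> = lower a \<alpha> + lower b \<alpha>"
    and "upper (a \<oplus>\<^sub>F b) \<alpha> = upper a \<alpha> + upper b \<alpha>"
  unfolding fuzzy_add_def
  by (rule fuzzy_of_levels[OF _ _ _ _ _ _ _ assms];
      intro add_mono lower_mono upper_antimono tendsto_add lower_left_continuous
        upper_left_continuous lower_right_continuous_0 upper_right_continuous_0 level_eq(2);
      simp)+

lemma fuzzy_scale_ends: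
  assumes "\<alpha> \<in> {0..1}"
  shows "lower (c \<odot>\<^sub>F a) \<alpha> = (if c \<ge> 0 then c * lower a \<alpha> else c * upper a \<alpha>)"
    and "upper (c \<odot>\<^sub>F a) \<alpha> = (if c \<ge> 0 then c * upper a \<alpha> else c * lower a \<alpha>)"
proof -
  have "lower (c \<odot>\<^sub>F a) \<alpha> = c * lower a \<alpha> \<and> upper (c \<odot>\<^sub>F a) \<alpha> = c * upper a \<alpha>" if "c \<ge> 0"
    unfolding fuzzy_scale_def if_P[OF that]
    by (rule conjI; rule fuzzy_of_levels[OF _ _ _ _ _ _ _ assms];
        intro mult_left_mono lower_mono upper_antimono tendsto_mult_left lower_left_continuous
          upper_left_continuous lower_right_continuous_0 upper_right_continuous_0 level_eq(2);
        use that in simp)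
  moreover have "lower (c \<odot>\<^sub>F a) \<alpha> = c * upper a \<alpha> \<and> upper (c \<odot>\<^sub>F a) \<alpha> = c * lower a \<alpha>"
    if "\<not> c \<ge> 0"
    unfolding fuzzy_scale_def if_not_P[OF that]
    by (rule conjI; rule fuzzy_of_levels[OF _ _ _ _ _ _ _ assms];
        intro mult_left_mono_neg lower_mono upper_antimono tendsto_mult_left lower_left_continuous
          upper_left_continuous lower_right_continuous_0 upper_right_continuous_0 level_eq(2);
        use that in simp)
  ultimately show "lower (c \<odot>\<^sub>F a) \<alpha> = (if c \<ge> 0 then c * lower a \<alpha> else c * upper a \<alpha>)"
    "upper (c \<odot>\<^sub>F a) \<alpha> = (if c \<ge> 0 then c * upper a \<alpha> else c * lower a \<alpha>)"
    by auto
qed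

section \<open>Order\<close>

definition fuzzy_less :: "fuzzy \<Rightarrow> fuzzy \<Rightarrow> bool"  (infix \<open>\<prec>\<^sub>F\<close> 50) where
  "a \<prec>\<^sub>F b \<longleftrightarrow> integral {0..1} (\<lambda>\<alpha>. \<alpha> * (lower a \<alpha> + upper a \<alpha>))
            < integral {0..1} (\<lambda>\<alpha>. \<alpha> * (lower b \<alpha> + upper b \<alpha>))"

section \<open>Generalized Hukuhara difference and derivative\<close>

definition is_gH_diff :: "fuzzy \<Rightarrow> fuzzy \<Rightarrow> fuzzy \<Rightarrow> bool" where
  "is_gH_diff a b c \<longleftrightarrow> a = b \<oplus>\<^sub>F c \<or> b = a \<oplus>\<^sub>F ((- 1) \<odot>\<^sub>F c)"

definition gH_diff :: "fuzzy \<Rightarrow> fuzzy \<Rightarrow> fuzzy"  (infixl \<open>\<ominus>\<^sub>g\<^sub>H\<close> 65) where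
  "a \<ominus>\<^sub>g\<^sub>H b = (THE c. is_gH_diff a b c)"

lemma is_gH_diff_ends:
  assumes "is_gH_diff a b c" "\<alpha> \<in> {0..1}"
  shows "lower c \<alpha> = min (lower a \<alpha> - lower b \<alpha>) (upper a \<alpha> - upper b \<alpha>)"
    and "upper c \<alpha> = max (lower a \<alpha> - lower b \<alpha>) (upper a \<alpha> - upper b \<alpha>)"
  using assms level_eq(2)[OF assms(2), of c]
  by (auto simp: is_gH_diff_def fuzzy_add_ends fuzzy_scale_ends)

lemma gH_diff_eq:
  assumes "is_gH_diff a b c"
  shows "a \<ominus>\<^sub>g\<^sub>H b = c"
  unfolding gH_diff_def
proof (rule the_equality)
  show "is_gH_diff a b c" by (fact assms)
  show "d = c" if "is_gH_diff a b d" for d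
    using is_gH_diff_ends[OF that] is_gH_diff_ends[OF assms] by (intro fuzzy_eqI_ends) auto
qed

text \<open>
  The difference quotient must make sense, i.e. the gH-difference must exist, for all
  sufficiently small nonzero increments. Everything is local, so the values of a function
  outside its open domain are irrelevant.
\<close>

definition has_gH_derivative :: "(real \<Rightarrow> fuzzy) \<Rightarrow> fuzzy \<Rightarrow> real \<Rightarrow> bool" where
  "has_gH_derivative g D x \<longleftrightarrow>
     (\<forall>\<^sub>F h in at 0. \<exists>c. is_gH_diff (g (x + h)) (g x) c) \<and>
     ((\<lambda>h. (1 / h) \<odot>\<^sub>F (g (x + h) \<ominus>\<^sub>g\<^sub>H g x)) \<longlongrightarrow> D) (at 0)"

definition coord_section :: "(real ^ 'n \<Rightarrow> 'a) \<Rightarrow> 'n \<Rightarrow> real ^ 'n \<Rightarrow> real \<Rightarrow> 'a" where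
  "coord_section f i x t = f (\<chi> k. if k = i then t else x $ k)"

definition has_gH_partial :: "(real ^ 'n \<Rightarrow> fuzzy) \<Rightarrow> 'n \<Rightarrow> fuzzy \<Rightarrow> real ^ 'n \<Rightarrow> bool" where
  "has_gH_partial f i D x \<longleftrightarrow> has_gH_derivative (coord_section f i x) D (x $ i)"

definition gH_partial :: "(real ^ 'n \<Rightarrow> fuzzy) \<Rightarrow> 'n \<Rightarrow> real ^ 'n \<Rightarrow> fuzzy" where
  "gH_partial f i x = (THE D. has_gH_partial f i D x)"

lemma gH_partial_eq:
  assumes "has_gH_partial f i D x"
  shows "gH_partial f i x = D"
  unfolding gH_partial_def
proof (rule the_equality)
  show "has_gH_partial f i D x" by (fact assms)
  show "E = D" if "has_gH_partial f i E x" for E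
    using assms that tendsto_unique[OF at_neq_bot]
    unfolding has_gH_partial_def has_gH_derivative_def by blast
qed

definition gH_differentiable_at :: "(real ^ 'n \<Rightarrow> fuzzy) \<Rightarrow> real ^ 'n \<Rightarrow> bool" where
  "gH_differentiable_at f x \<longleftrightarrow>
     (\<exists>i. (\<exists>D. has_gH_partial f i D x) \<and>
          (\<forall>j. j \<noteq> i \<longrightarrow> (\<forall>\<^sub>F y in nhds x. \<exists>D. has_gH_partial f j D y) \<and>
                        isCont (gH_partial f j) x))"

definition gH_differentiable_on :: "(real ^ 'n \<Rightarrow> fuzzy) \<Rightarrow> (real ^ 'n) set \<Rightarrow> bool" where
  "gH_differentiable_on f X \<longleftrightarrow> (\<forall>x\<in>X. gH_differentiable_at f x)"

text \<open>
  The set \<open>X\<close> enters because the gradient must exist as a function on \<open>X\<close> before its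
  components can be differentiated at \<open>x\<close>.
\<close>

definition twice_gH_differentiable_at ::
    "(real ^ 'n) set \<Rightarrow> (real ^ 'n \<Rightarrow> fuzzy) \<Rightarrow> real ^ 'n \<Rightarrow> bool" where
  "twice_gH_differentiable_at X f x \<longleftrightarrow>
     gH_differentiable_on f X \<and> (\<forall>i. gH_differentiable_at (gH_partial f i) x)"

definition twice_continuously_gH_differentiable_on ::
    "(real ^ 'n \<Rightarrow> fuzzy) \<Rightarrow> (real ^ 'n) set \<Rightarrow> bool" where
  "twice_continuously_gH_differentiable_on f X \<longleftrightarrow>
     (\<forall>x\<in>X. twice_gH_differentiable_at X f x) \<and>
     (\<forall>i j. continuous_on X (gH_partial (gH_partial f i) j))"

section \<open>Ordinary gradient and Hessian\<close>

text \<open>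
  Below these are applied only to the sums \<open>lower (f x) \<alpha> + upper (f x) \<alpha>\<close>. For a gH-difference
  the sum of the endpoints is the difference of the sums, so gH-differentiability of \<open>f\<close>
  makes all the partial derivatives that occur exist, although those of
  \<open>lower (f x) \<alpha>\<close> and \<open>upper (f x) \<alpha>\<close> separately need not.
\<close>

definition partial_deriv :: "(real ^ 'n \<Rightarrow> real) \<Rightarrow> 'n \<Rightarrow> real ^ 'n \<Rightarrow> real" where
  "partial_deriv g i x = deriv (coord_section g i x) (x $ i)"

definition gradient :: "(real ^ 'n \<Rightarrow> real) \<Rightarrow> real ^ 'n \<Rightarrow> real ^ 'n" where
  "gradient g x = (\<chi> i. partial_deriv g i x)"

definition hessian :: "(real ^ 'n \<Rightarrow> real) \<Rightarrow> real ^ 'n \<Rightarrow> real ^ 'n ^ 'n" where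
  "hessian g x = (\<chi> i j. partial_deriv (partial_deriv g i) j x)"

text \<open>
  Symmetry is not demanded; the matrix to which this is applied below is an integral of
  Hessians of \<open>C\<^sup>2\<close> functions, hence symmetric anyway.
\<close>

definition positive_definite :: "real ^ 'n ^ 'n \<Rightarrow> bool" where
  "positive_definite A \<longleftrightarrow> (\<forall>v. v \<noteq> 0 \<longrightarrow> v \<bullet> (A *v v) > 0)"

section \<open>Minimizers\<close>

definition strict_local_minimizer ::
    "(real ^ 'n \<Rightarrow> fuzzy) \<Rightarrow> (real ^ 'n) set \<Rightarrow> real ^ 'n \<Rightarrow> bool" where
  "strict_local_minimizer f X xs \<longleftrightarrow>
     xs \<in> X \<and>
     (\<exists>\<epsilon>>0. \<forall>x\<in>X. 0 < norm (x - xs) \<and> norm (x - xs) < \<epsilon> \<longrightarrow> f xs \<prec>\<^sub>F f x)"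

end

theory Submission
  imports Defs
begin

text \<open>
  The functional \<open>\<Phi> a = \<integral>\<^sub>0\<^sup>1 \<alpha> (a\<^sub>\<alpha>\<^sup>L + a\<^sub>\<alpha>\<^sup>U) d\<alpha>\<close>, which induces the order, is Lipschitz, homogeneous,
  and turns gH-differences into differences, because taking minimum and maximum of the endpoint
  differences does not change their sum. The same holds for \<open>a \<mapsto> a\<^sub>\<alpha>\<^sup>L + a\<^sub>\<alpha>\<^sup>U\<close>. Such a functional
  commutes with gH-differentiation. Hence \<open>F = \<Phi> \<circ> f\<close> is a real \<open>C\<^sup>2\<close> function, and its
  gradient and Hessian at \<open>xs\<close> are the integrals in the two hypotheses, so the classical second
  order sufficient condition applies to \<open>F\<close>.
\<close>

section \<open>Functionals compatible with the gH-difference\<close>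

text \<open>\<open>scale\<close> must cover negative factors because difference quotients multiply
  by 1/h on both sides of 0. \<open>lipschitz\<close> carries limits in the fuzzy metric over to
  real limits. The endpoint sums serve to read the hypotheses, the weighted integral to read the
  order.\<close>

locale gH_linear_functional =
  fixes P :: "fuzzy \<Rightarrow> real" and K :: real
  assumes scale: "P (c \<odot>\<^sub>F a) = c * P a"
    and gH_diff: "is_gH_diff a b d \<Longrightarrow> P d = P a - P b"
    and lipschitz: "\<bar>P a - P b\<bar> \<le> K * dist a b"
begin

lemma tendsto:
  assumes "(g \<longlongrightarrow> a) F"
  shows "((\<lambda>x. P (g x)) \<longlongrightarrow> P a) F"
proof (rule iffD2[OF tendsto_dist_iff], rule Lim_null_comparison)
  show "\<forall>\<^sub>F x in F. norm (dist (P (g x)) (P a)) \<le> K * dist (g x) a"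
    using lipschitz by (simp add: dist_real_def)
  show "((\<lambda>x. K * dist (g x) a) \<longlongrightarrow> 0) F"
    using tendsto_mult_right_zero[OF iffD1[OF tendsto_dist_iff assms]] .
qed

lemma has_real_derivative:
  assumes "has_gH_derivative g D x"
  shows "((\<lambda>t. P (g t)) has_real_derivative P D) (at x)"
proof -
  have "((\<lambda>h. P ((1 / h) \<odot>\<^sub>F (g (x + h) \<ominus>\<^sub>g\<^sub>H g x))) \<longlongrightarrow> P D) (at 0)"
    using assms by (intro tendsto) (simp add: has_gH_derivative_def)
  \<comment> \<open>For small nonzero h the gH-difference exists, so the definite description in
    \<open>gH_diff\<close> denotes it and P passes through.\<close>
  moreover have "\<forall>\<^sub>F h in at 0. P ((1 / h) \<odot>\<^sub>F (g (x + h) \<ominus>\<^sub>g\<^sub>H g x)) = (P (g (x + h)) - P (g x)) / h"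
    using assms[unfolded has_gH_derivative_def, THEN conjunct1]
  proof eventually_elim
    case (elim h)
    then show ?case using gH_diff gH_diff_eq scale by fastforce
  qed
  ultimately show ?thesis
    unfolding DERIV_def by (rule Lim_transform_eventually)
qed

lemma has_partial:
  assumes "has_gH_partial f i D x"
  shows "(coord_section (\<lambda>y. P (f y)) i x has_real_derivative P D) (at (x $ i))"
  using has_real_derivative[OF assms[unfolded has_gH_partial_def]]
  by (simp add: coord_section_def[abs_def])

lemma partial_deriv_eq:
  assumes "has_gH_partial f i D x"
  shows "partial_deriv (\<lambda>y. P (f y)) i x = P D"
  unfolding partial_deriv_def by (rule DERIV_imp_deriv[OF has_partial[OF assms]])

end

section \<open>Endpoint sums and their weighted integral as instances\<close>

lemma gH_linear_functional_ends:
  assumes "\<alpha> \<in> {0..1}"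
  shows "gH_linear_functional (\<lambda>a. lower a \<alpha> + upper a \<alpha>) 2"
proof
  \<comment> \<open>A negative factor swaps the two endpoints, which leaves their sum
    unaffected.\<close>
  show "lower (c \<odot>\<^sub>F a) \<alpha> + upper (c \<odot>\<^sub>F a) \<alpha> = c * (lower a \<alpha> + upper a \<alpha>)" for c a
    by (simp add: fuzzy_scale_ends[OF assms] algebra_simps)
  show "lower d \<alpha> + upper d \<alpha> = lower a \<alpha> + upper a \<alpha> - (lower b \<alpha> + upper b \<alpha>)"
    if "is_gH_diff a b d" for a b d
    by (simp add: is_gH_diff_ends[OF that assms])
  show "\<bar>lower a \<alpha> + upper a \<alpha> - (lower b \<alpha> + upper b \<alpha>)\<bar> \<le> 2 * dist a b" for a b
    using fuzzy_dist_upper[OF assms, of a b] by linarith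
qed

definition fuzzy_rank :: "fuzzy \<Rightarrow> real" where
  "fuzzy_rank a = integral {0..1} (\<lambda>\<alpha>. \<alpha> * (lower a \<alpha> + upper a \<alpha>))"

text \<open>The endpoints are monotone in \<alpha> but may jump, and multiplying by \<alpha> can
  destroy monotonicity when they change sign. Subtracting the values at 0 makes both factors
  nonnegative and increasing; the correction is linear in \<alpha>.\<close>

lemma fuzzy_rank_integrable: "(\<lambda>\<alpha>. \<alpha> * (lower a \<alpha> + upper a \<alpha>)) integrable_on {0..1}"
proof -
  have "mono_on {0..1} (\<lambda>\<alpha>. \<alpha> * (lower a \<alpha> - lower a 0))"
    by (intro mono_onI mult_mono) (auto intro: lower_mono)
  moreover have "mono_on {0..1} (\<lambda>\<alpha>. \<alpha> * (upper a 0 - upper a \<alpha>))"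
    by (intro mono_onI mult_mono) (auto intro: upper_antimono)
  moreover have "(\<lambda>\<alpha>. \<alpha> * (lower a 0 + upper a 0)) integrable_on {0..1}"
    by (intro integrable_continuous_real continuous_intros)
  ultimately have "(\<lambda>\<alpha>. (\<alpha> * (lower a \<alpha> - lower a 0) - \<alpha> * (upper a 0 - upper a \<alpha>))
      + \<alpha> * (lower a 0 + upper a 0)) integrable_on {0..1}"
    by (rule integrable_add[OF integrable_diff[OF integrable_on_mono_on integrable_on_mono_on]])
  then show ?thesis by (simp add: algebra_simps)
qed

lemma gH_linear_functional_rank: "gH_linear_functional fuzzy_rank 2"
proof
  note ends = gH_linear_functional_ends
  show "fuzzy_rank (c \<odot>\<^sub>F a) = c * fuzzy_rank a" for c a
  proof -
    have "fuzzy_rank (c \<odot>\<^sub>F a) = integral {0..1} (\<lambda>\<alpha>. c * (\<alpha> * (lower a \<alpha> + upper a \<alpha>)))"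
      unfolding fuzzy_rank_def
      by (rule integral_cong) (simp add: gH_linear_functional.scale[OF ends])
    then show ?thesis by (simp add: fuzzy_rank_def)
  qed
  show "fuzzy_rank d = fuzzy_rank a - fuzzy_rank b" if "is_gH_diff a b d" for a b d
    unfolding fuzzy_rank_def integral_diff[OF fuzzy_rank_integrable fuzzy_rank_integrable, symmetric]
    by (rule integral_cong)
      (simp add: gH_linear_functional.gH_diff[OF ends that] right_diff_distrib)
  show "\<bar>fuzzy_rank a - fuzzy_rank b\<bar> \<le> 2 * dist a b" for a b
  proof -
    have "norm (integral {0..1} (\<lambda>\<alpha>. \<alpha> * (lower a \<alpha> + upper a \<alpha>) - \<alpha> * (lower b \<alpha> + upper b \<alpha>)))
        \<le> integral {0..1::real} (\<lambda>\<alpha>. 2 * dist a b)"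
    proof (rule integral_norm_bound_integral)
      fix \<alpha> :: real assume \<alpha>: "\<alpha> \<in> {0..1}"
      \<comment> \<open>Bounding the weight \<alpha> by 1 is coarser than integrating it, but any
        Lipschitz constant will do.\<close>
      have "\<bar>\<alpha> * (lower a \<alpha> + upper a \<alpha> - (lower b \<alpha> + upper b \<alpha>))\<bar> \<le> 1 * (2 * dist a b)"
        unfolding abs_mult
        using \<alpha> gH_linear_functional.lipschitz[OF ends[OF \<alpha>], of a b] by (intro mult_mono) auto
      then show "norm (\<alpha> * (lower a \<alpha> + upper a \<alpha>) - \<alpha> * (lower b \<alpha> + upper b \<alpha>)) \<le> 2 * dist a b"
        by (simp add: right_diff_distrib)
    qed (intro integrable_diff fuzzy_rank_integrable integrable_const_ivl)+
    then show ?thesis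
      by (simp add: fuzzy_rank_def integral_diff[OF fuzzy_rank_integrable fuzzy_rank_integrable])
  qed
qed

text \<open>All partials but one exist on a neighbourhood, which contains x; the remaining one
  exists at x by definition.\<close>

lemma gH_differentiable_at_has_partial:
  assumes "gH_differentiable_at f x"
  shows "has_gH_partial f i (gH_partial f i x) x"
proof -
  obtain k where k: "\<exists>D. has_gH_partial f k D x"
    "\<And>j. j \<noteq> k \<Longrightarrow> \<forall>\<^sub>F y in nhds x. \<exists>D. has_gH_partial f j D y"
    using assms unfolding gH_differentiable_at_def by blast
  have "\<exists>D. has_gH_partial f i D x"
    using k(1) eventually_nhds_x_imp_x[OF k(2)[of i]] by (cases "i = k") auto
  then show ?thesis using gH_partial_eq by blast
qed

section \<open>The second order sufficient condition\<close>

text \<open>This allows a function to be replaced by one that agrees with it only on X before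
  differentiating in one coordinate.\<close>

lemma eventually_coord_section_in:
  fixes x :: "real ^ 'n"
  assumes "open X" "x \<in> X"
  shows "\<forall>\<^sub>F t in nhds (x $ i). (\<chi> k. if k = i then t else x $ k) \<in> X"
proof -
  have "((\<lambda>t. \<chi> k. if k = i then t else x $ k) \<longlongrightarrow> (\<chi> k. if k = i then x $ i else x $ k))
      (nhds (x $ i))"
    by (intro tendsto_vec_lambda) (simp add: filterlim_ident)
  moreover have "(\<chi> k. if k = i then x $ i else x $ k) = x"
    by (simp add: vec_eq_iff)
  ultimately show ?thesis
    using assms by (auto dest: topological_tendstoD)
qed

text \<open>The endpoints come in either order or coincide, since a coordinate may increase,
  decrease or stay fixed between two points.\<close>

lemma mvt_closed_segment:
  fixes g :: "real \<Rightarrow> real"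
  assumes "\<And>t. t \<in> closed_segment a b \<Longrightarrow> (g has_real_derivative g' t) (at t)"
  obtains t where "t \<in> closed_segment a b" "g b - g a = (b - a) * g' t"
proof -
  consider "a < b" | "a = b" | "b < a" by linarith
  then show ?thesis
  proof cases
    case 1
    then obtain t where "a < t" "t < b" "g b - g a = (b - a) * g' t"
      using MVT2[of a b g g'] assms by (auto simp: closed_segment_eq_real_ivl)
    then show ?thesis using that[of t] 1 by (simp add: closed_segment_eq_real_ivl)
  next
    case 2
    then show ?thesis using that[of a] by simp
  next
    case 3
    then obtain t where "b < t" "t < a" "g a - g b = (a - b) * g' t"
      using MVT2[of b a g g'] assms by (auto simp: closed_segment_eq_real_ivl)
    then show ?thesis using that[of t] 3 by (simp add: closed_segment_eq_real_ivl algebra_simps)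
  qed
qed

text \<open>gH-differentiability gives information along the axes only; continuity of the partials
  upgrades it to a full derivative, as needed for moving in arbitrary directions.\<close>

lemma has_derivative_continuous_partials:
  fixes F :: "real ^ 'n \<Rightarrow> real"
  assumes "open X" "x \<in> X"
    and deriv: "\<And>y i. y \<in> X \<Longrightarrow> (coord_section F i y has_real_derivative G i y) (at (y $ i))"
    and cont: "\<And>i. isCont (G i) x"
  shows "(F has_derivative (\<lambda>h. \<Sum>i\<in>UNIV. G i x * h $ i)) (at x)"
proof -
  define Q where "Q S y = (\<chi> k. if k \<in> S then y $ k else x $ k)" for S and y :: "real ^ 'n"
  \<comment> \<open>Coordinates are released one at a time; each step is the mean value theorem in one variable.\<close>
  have "\<forall>e>0. \<exists>d>0. \<forall>y. norm (y - x) < d \<longrightarrow>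
      norm (F (Q S y) - F x - (\<Sum>i\<in>S. G i x * (y - x) $ i)) \<le> e * norm (y - x)"
    if "finite S" for S
    using that
  proof (induction S rule: finite_induct)
    case empty
    have "Q {} y = x" for y by (simp add: Q_def)
    then show ?case by (auto intro: exI[of _ 1])
  next
    case (insert j S)
    show ?case
    proof (intro allI impI)
      fix e :: real assume "e > 0"
      \<comment> \<open>Half of the error e is spent on the coordinates already released, half on
        coordinate j; d3 keeps the path inside X.\<close>
      then obtain d1 where d1: "d1 > 0" "\<And>y. norm (y - x) < d1 \<Longrightarrow>
          norm (F (Q S y) - F x - (\<Sum>i\<in>S. G i x * (y - x) $ i)) \<le> e / 2 * norm (y - x)"
        using insert.IH[rule_format, of "e / 2"] by auto
      obtain d2 where d2: "d2 > 0" "\<And>z. norm (z - x) < d2 \<Longrightarrow> \<bar>G j z - G j x\<bar> < e / 2"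
        using cont[of j] \<open>e > 0\<close> unfolding continuous_at_eps_delta dist_norm
        by (metis half_gt_zero real_norm_def)
      obtain d3 where d3: "d3 > 0" "ball x d3 \<subseteq> X"
        using assms(1,2) open_contains_ball by blast
      define d where "d = min d1 (min d2 d3)"
      show "\<exists>d>0. \<forall>y. norm (y - x) < d \<longrightarrow>
          norm (F (Q (insert j S) y) - F x - (\<Sum>i\<in>insert j S. G i x * (y - x) $ i)) \<le> e * norm (y - x)"
      proof (intro exI[of _ d] conjI allI impI)
        show "d > 0" using d1 d2 d3 by (simp add: d_def)
        fix y assume y: "norm (y - x) < d"
        \<comment> \<open>R moves coordinate j alone, from \<open>Q S y\<close> to
          \<open>Q (insert j S) y\<close>. Each coordinate stays between those of x and y, so the
          path is never farther from x than y is.\<close>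
        define R where "R t = (\<chi> k. if k = j then t else Q S y $ k)" for t
        have R: "norm (R t - x) \<le> norm (y - x)" if "t \<in> closed_segment (x $ j) (y $ j)" for t
        proof (rule norm_le_componentwise_cart)
          show "norm ((R t - x) $ k) \<le> norm ((y - x) $ k)" for k
            using that by (auto simp: R_def Q_def closed_segment_eq_real_ivl split: if_splits)
        qed
        have sec: "coord_section F j (R t) = (\<lambda>u. F (R u))" for t
          unfolding coord_section_def R_def
          by (intro ext arg_cong[where f = F]) (simp add: vec_eq_iff)
        have "((\<lambda>u. F (R u)) has_real_derivative G j (R t)) (at t)"
          if "t \<in> closed_segment (x $ j) (y $ j)" for t
        proof -
          have "R t \<in> X"
            using R[OF that] y d3 by (auto simp: d_def dist_norm norm_minus_commute subset_iff)
          moreover have "R t $ j = t" by (simp add: R_def)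
          ultimately show ?thesis using deriv[of "R t" j] by (simp add: sec)
        qed
        then obtain t where t: "t \<in> closed_segment (x $ j) (y $ j)"
          "F (R (y $ j)) - F (R (x $ j)) = (y $ j - x $ j) * G j (R t)"
          by (rule mvt_closed_segment)
        have ends: "R (y $ j) = Q (insert j S) y" "R (x $ j) = Q S y"
          using insert.hyps by (auto simp: R_def Q_def vec_eq_iff)
        have "\<bar>(y $ j - x $ j) * (G j (R t) - G j x)\<bar> \<le> norm (y - x) * (e / 2)"
          unfolding abs_mult
          using R[OF t(1)] y d2(2)[of "R t"] component_le_norm_cart[of "y - x" j]
          by (intro mult_mono) (auto simp: d_def)
        moreover have "\<bar>F (Q S y) - F x - (\<Sum>i\<in>S. G i x * (y - x) $ i)\<bar> \<le> e / 2 * norm (y - x)"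
          using d1(2)[of y] y by (simp add: d_def)
        moreover have "F (Q (insert j S) y) - F x - (\<Sum>i\<in>insert j S. G i x * (y - x) $ i)
            = (F (Q S y) - F x - (\<Sum>i\<in>S. G i x * (y - x) $ i))
              + (y $ j - x $ j) * (G j (R t) - G j x)"
          using t(2) insert.hyps by (simp add: ends algebra_simps)
        ultimately show "norm (F (Q (insert j S) y) - F x - (\<Sum>i\<in>insert j S. G i x * (y - x) $ i))
            \<le> e * norm (y - x)"
          unfolding real_norm_def by argo
      qed
    qed
  qed
  from this[of UNIV] have "\<forall>e>0. \<exists>d>0. \<forall>y. norm (y - x) < d \<longrightarrow>
      norm (F y - F x - (\<Sum>i\<in>UNIV. G i x * (y - x) $ i)) \<le> e * norm (y - x)"
    by (simp add: Q_def)
  moreover have "bounded_linear (\<lambda>h::real ^ 'n. \<Sum>i\<in>UNIV. G i x * h $ i)"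
    by (intro bounded_linear_sum bounded_linear_const_mult bounded_linear_vec_nth)
  ultimately show ?thesis by (simp add: has_derivative_at_alt)
qed

text \<open>The quadratic form attains a positive minimum c on the compact unit sphere; homogeneity
  of degree 2 extends the bound to all vectors.\<close>

lemma positive_definite_coercive:
  fixes A :: "real ^ 'n ^ 'n"
  assumes "positive_definite A"
  obtains c where "c > 0" "\<And>v. c * (norm v)\<^sup>2 \<le> v \<bullet> (A *v v)"
proof -
  have "continuous_on (sphere 0 1) (\<lambda>v. v \<bullet> (A *v v))"
    by (intro continuous_intros linear_continuous_on matrix_vector_mul_bounded_linear)
  \<comment> \<open>A minimum needs a nonempty sphere; any coordinate vector is a witness, so the
    index is arbitrary.\<close>
  moreover have "axis undefined 1 \<in> sphere (0 :: real ^ 'n) 1"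
    by simp
  ultimately obtain u where u: "u \<in> sphere 0 1" "\<And>v. v \<in> sphere 0 1 \<Longrightarrow> u \<bullet> (A *v u) \<le> v \<bullet> (A *v v)"
    using continuous_attains_inf[of "sphere (0 :: real ^ 'n) 1" "\<lambda>v. v \<bullet> (A *v v)"]
    by (metis compact_sphere empty_iff)
  show ?thesis
  proof (rule that)
    show "u \<bullet> (A *v u) > 0"
      using u(1) assms unfolding positive_definite_def by (metis mem_sphere_0 norm_zero zero_neq_one)
    fix v :: "real ^ 'n"
    show "u \<bullet> (A *v u) * (norm v)\<^sup>2 \<le> v \<bullet> (A *v v)"
    proof (cases "v = 0")
      case False
      define w where "w = v /\<^sub>R norm v"
      have "w \<in> sphere 0 1" using False by (simp add: w_def)
      then have "u \<bullet> (A *v u) * (norm v)\<^sup>2 \<le> (w \<bullet> (A *v w)) * (norm v)\<^sup>2"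
        by (intro mult_right_mono u(2)) auto
      also have "\<dots> = (norm v *\<^sub>R w) \<bullet> (A *v (norm v *\<^sub>R w))"
        by (simp add: matrix_vector_mult_scaleR power2_eq_square)
      also have "norm v *\<^sub>R w = v" using False by (simp add: w_def)
      finally show ?thesis .
    qed simp
  qed
qed

text \<open>In place of a second order Taylor formula, the mean value theorem on the segment from x
  to y is combined with the first order expansion of the gradient at x, where the gradient
  vanishes.\<close>

lemma second_order_sufficient_condition:
  fixes F :: "real ^ 'n \<Rightarrow> real"
  assumes X: "open X" "x \<in> X"
    and derivF: "\<And>y i. y \<in> X \<Longrightarrow> (coord_section F i y has_real_derivative G i y) (at (y $ i))"
    and derivG: "\<And>y i j. y \<in> X \<Longrightarrow> (coord_section (G i) j y has_real_derivative H i j y) (at (y $ j))"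
    and contH: "\<And>i j. continuous_on X (H i j)"
    and crit: "\<And>i. G i x = 0"
    and pos: "positive_definite (\<chi> i j. H i j x)"
  obtains \<epsilon> where "\<epsilon> > 0" "\<And>y. 0 < norm (y - x) \<Longrightarrow> norm (y - x) < \<epsilon> \<Longrightarrow> F x < F y"
proof -
  define A where "A = (\<chi> i j. H i j x)"
  define g where "g y = (\<chi> i. G i y)" for y
  \<comment> \<open>Continuous second partials make each \<open>G i\<close> differentiable, hence
    continuous, which is what the same lemma then requires for F.\<close>
  have DG: "(G i has_derivative (\<lambda>h. \<Sum>j\<in>UNIV. H i j y * h $ j)) (at y)" if "y \<in> X" for i y
    using X(1) that derivG contH
    by (intro has_derivative_continuous_partials[of X]) (auto simp: continuous_on_eq_continuous_at)
  have DF: "(F has_derivative (\<lambda>h. g y \<bullet> h)) (at y)" if "y \<in> X" for y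
  proof -
    have "(F has_derivative (\<lambda>h. \<Sum>i\<in>UNIV. G i y * h $ i)) (at y)"
      using X(1) that derivF DG has_derivative_continuous
      by (intro has_derivative_continuous_partials[of X]) blast+
    then show ?thesis by (simp add: g_def inner_vec_def)
  qed
  have "(g has_derivative (\<lambda>h. A *v h)) (at x)"
    unfolding has_derivative_componentwise_within[of g]
  proof
    fix b :: "real ^ 'n" assume "b \<in> Basis"
    then obtain i where "b = axis i 1" by (auto simp: Basis_vec_def)
    then show "((\<lambda>y. g y \<bullet> b) has_derivative (\<lambda>h. (A *v h) \<bullet> b)) (at x)"
      using DG[OF X(2), of i] by (simp add: inner_axis g_def A_def matrix_vector_mult_def)
  qed
  moreover obtain c where c: "c > 0" "\<And>v. c * (norm v)\<^sup>2 \<le> v \<bullet> (A *v v)"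
    using positive_definite_coercive pos unfolding A_def by blast
  moreover have "g x = 0" by (simp add: g_def crit vec_eq_iff)
  \<comment> \<open>With c / 2 the remainder can cancel at most half of the quadratic term.\<close>
  ultimately obtain d where d: "d > 0"
    "\<And>y. norm (y - x) < d \<Longrightarrow> norm (g y - A *v (y - x)) \<le> c / 2 * norm (y - x)"
    unfolding has_derivative_at_alt by (metis diff_zero half_gt_zero)
  obtain r where r: "r > 0" "ball x r \<subseteq> X"
    using X open_contains_ball by blast
  show ?thesis
  proof (rule that)
    show "min d r > 0" using d r by simp
    fix y assume y: "0 < norm (y - x)" "norm (y - x) < min d r"
    define v where "v = y - x"
    have small: "norm (t *\<^sub>R v) < min d r" if "0 \<le> t" "t \<le> 1" for t
      using le_less_trans[OF mult_left_le_one_le[of "norm v" t] y(2)[folded v_def]] that by simp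
    have "((\<lambda>t. F (x + t *\<^sub>R v)) has_real_derivative g (x + t *\<^sub>R v) \<bullet> v) (at t)"
      if "0 \<le> t" "t \<le> 1" for t
    proof -
      have "x + t *\<^sub>R v \<in> X" using small[OF that] r by (auto simp: dist_norm subset_iff)
      moreover have "((\<lambda>t. x + t *\<^sub>R v) has_derivative (\<lambda>s. s *\<^sub>R v)) (at t)"
        by (auto intro!: derivative_eq_intros)
      ultimately have "((\<lambda>t. F (x + t *\<^sub>R v)) has_derivative (\<lambda>s. g (x + t *\<^sub>R v) \<bullet> (s *\<^sub>R v))) (at t)"
        using has_derivative_compose DF by blast
      then show ?thesis by (simp add: has_field_derivative_def mult_commute_abs)
    qed
    \<comment> \<open>Strict positivity of t matters: both the quadratic term and the bound on its
      error are proportional to t.\<close>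
    then obtain t where t: "0 < t" "t < 1" "F (x + 1 *\<^sub>R v) - F (x + 0 *\<^sub>R v) = (1 - 0) * (g (x + t *\<^sub>R v) \<bullet> v)"
      using MVT2[of 0 1 "\<lambda>t. F (x + t *\<^sub>R v)" "\<lambda>t. g (x + t *\<^sub>R v) \<bullet> v"] by auto
    let ?e = "g (x + t *\<^sub>R v) - A *v (t *\<^sub>R v)"
    have "norm ?e \<le> c / 2 * norm (t *\<^sub>R v)"
      using d(2)[of "x + t *\<^sub>R v"] small[of t] t by simp
    then have "\<bar>?e \<bullet> v\<bar> \<le> c / 2 * norm (t *\<^sub>R v) * norm v"
      by (meson Cauchy_Schwarz_ineq2 mult_right_mono norm_ge_zero order_trans)
    then have "\<bar>?e \<bullet> v\<bar> \<le> t * (c * (norm v)\<^sup>2) / 2"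
      using t by (simp add: power2_eq_square mult.commute mult.left_commute)
    moreover have "t * (c * (norm v)\<^sup>2) \<le> t * (v \<bullet> (A *v v))"
      using t c(2) by (intro mult_left_mono) auto
    moreover have "g (x + t *\<^sub>R v) \<bullet> v = ?e \<bullet> v + t * (v \<bullet> (A *v v))"
      by (simp add: inner_diff_left matrix_vector_mult_scaleR inner_commute[of v])
    moreover have "t * (c * (norm v)\<^sup>2) > 0"
      using t c(1) y by (simp add: v_def)
    ultimately have "g (x + t *\<^sub>R v) \<bullet> v > 0" by argo
    then show "F x < F y" using t(3) by (simp add: v_def)
  qed
qed

section \<open>Application to the fuzzy-valued objective\<close>

theorem theorem3p3:
  fixes X :: "(real ^ 'n) set" and f :: "real ^ 'n \<Rightarrow> fuzzy" and xs :: "real ^ 'n"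
  assumes "open X"
    and "twice_continuously_gH_differentiable_on f X"
    and "xs \<in> X"
    and "(\<chi> i. integral {0..1}
            (\<lambda>\<alpha>. \<alpha> * gradient (\<lambda>x. lower (f x) \<alpha> + upper (f x) \<alpha>) xs $ i)) = 0"
    and "positive_definite (\<chi> i j. integral {0..1}
            (\<lambda>\<alpha>. \<alpha> * hessian (\<lambda>x. lower (f x) \<alpha> + upper (f x) \<alpha>) xs $ i $ j))"
  shows "strict_local_minimizer f X xs"
proof -
  have partial1: "has_gH_partial f i (gH_partial f i x) x"
    and partial2: "has_gH_partial (gH_partial f i) j (gH_partial (gH_partial f i) j x) x"
    if "x \<in> X" for x i j
    using assms(2) that gH_differentiable_at_has_partial
    unfolding twice_continuously_gH_differentiable_on_def twice_gH_differentiable_at_def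
      gH_differentiable_on_def by blast+
  have ends1: "partial_deriv (\<lambda>x. lower (f x) \<alpha> + upper (f x) \<alpha>) i x
      = lower (gH_partial f i x) \<alpha> + upper (gH_partial f i x) \<alpha>"
    if "\<alpha> \<in> {0..1}" "x \<in> X" for \<alpha> i x
    using gH_linear_functional.partial_deriv_eq[OF gH_linear_functional_ends partial1] that by blast
  have ends2: "partial_deriv (partial_deriv (\<lambda>x. lower (f x) \<alpha> + upper (f x) \<alpha>) i) j xs
      = lower (gH_partial (gH_partial f i) j xs) \<alpha> + upper (gH_partial (gH_partial f i) j xs) \<alpha>"
    if "\<alpha> \<in> {0..1}" for \<alpha> i j
  proof -
    \<comment> \<open>The first partials are known from \<open>ends1\<close> on X only, so the inner
      function is replaced near xs, where X is a neighbourhood.\<close>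
    have "partial_deriv (partial_deriv (\<lambda>x. lower (f x) \<alpha> + upper (f x) \<alpha>) i) j xs
        = partial_deriv (\<lambda>x. lower (gH_partial f i x) \<alpha> + upper (gH_partial f i x) \<alpha>) j xs"
      unfolding partial_deriv_def[of _ j]
    proof (rule deriv_cong_ev)
      show "\<forall>\<^sub>F t in nhds (xs $ j).
          coord_section (partial_deriv (\<lambda>x. lower (f x) \<alpha> + upper (f x) \<alpha>) i) j xs t
          = coord_section (\<lambda>x. lower (gH_partial f i x) \<alpha> + upper (gH_partial f i x) \<alpha>) j xs t"
        using eventually_coord_section_in[OF assms(1,3), of j]
        by eventually_elim (simp add: coord_section_def ends1[OF that])
    qed simp
    also have "\<dots> = lower (gH_partial (gH_partial f i) j xs) \<alpha> + upper (gH_partial (gH_partial f i) j xs) \<alpha>"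
      by (rule gH_linear_functional.partial_deriv_eq[OF gH_linear_functional_ends[OF that] partial2[OF assms(3)]])
    finally show ?thesis .
  qed
  interpret rank: gH_linear_functional fuzzy_rank 2
    by (rule gH_linear_functional_rank)
  \<comment> \<open>No differentiation under the integral sign occurs: by \<open>ends1\<close> the
    integrand of the hypothesis is pointwise that of \<open>fuzzy_rank\<close> at the fuzzy partial.
    The Hessian is treated likewise through \<open>ends2\<close>.\<close>
  have crit: "fuzzy_rank (gH_partial f i xs) = 0" for i
  proof -
    have "fuzzy_rank (gH_partial f i xs) = integral {0..1}
        (\<lambda>\<alpha>. \<alpha> * gradient (\<lambda>x. lower (f x) \<alpha> + upper (f x) \<alpha>) xs $ i)"
      unfolding fuzzy_rank_def by (rule integral_cong) (simp add: gradient_def ends1 assms(3))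
    also have "\<dots> = 0" using assms(4) by (simp add: vec_eq_iff)
    finally show ?thesis .
  qed
  have "fuzzy_rank (gH_partial (gH_partial f i) j xs) = integral {0..1}
      (\<lambda>\<alpha>. \<alpha> * hessian (\<lambda>x. lower (f x) \<alpha> + upper (f x) \<alpha>) xs $ i $ j)" for i j
    unfolding fuzzy_rank_def by (rule integral_cong) (simp add: hessian_def ends2)
  then have pos: "positive_definite (\<chi> i j. fuzzy_rank (gH_partial (gH_partial f i) j xs))"
    using assms(5) by simp
  have cont: "continuous_on X (\<lambda>x. fuzzy_rank (gH_partial (gH_partial f i) j x))" for i j
    using assms(2) unfolding twice_continuously_gH_differentiable_on_def continuous_on_def
    by (blast intro: rank.tendsto)
  obtain \<epsilon> where "\<epsilon> > 0"
    "\<And>y. 0 < norm (y - xs) \<Longrightarrow> norm (y - xs) < \<epsilon> \<Longrightarrow> fuzzy_rank (f xs) < fuzzy_rank (f y)"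
    using second_order_sufficient_condition[OF assms(1,3) rank.has_partial[OF partial1]
        rank.has_partial[OF partial2] cont crit pos] by metis
  then show ?thesis
    using assms(3) unfolding strict_local_minimizer_def fuzzy_less_def fuzzy_rank_def by blast
qed

end
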